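(* Let $0<q<1$. For any $\eta\in\mathbb{N}=\{0,1,2,\dots\}$ and any integers $m\ge n\ge 1$, $$\mathbb{P}[G(m,n)\le\eta]=\det\big((\Delta^{j-i-1}w_m)(\eta+1)\big)_{1\le i,j\le n}.$$
   Context: Last-passage times: let $w(i,j)$, $i,j\ge 1$ integers, be independent geometric random variables with $\mathbb{P}[w(i,j)=k]=(1-q)q^k$ for $k=0,1,2,\dots$. For $m,n\ge 1$ set $G(m,n)=\max_\pi\sum_{(i,j)\in\pi}w(i,j)$, the maximum being over all up/right lattice paths $\pi$ from $(1,1)$ to $(m,n)$. Equivalently, $G(m,n)=\max(G(m-1,n),G(m,n-1))+w(m,n)$ with $G(0,n)=G(n,0)=0$ for $n\ge1$. Functions: $H(x)=1$ for $x\ge0$ and $H(x)=0$ for $x<0$. For $m\ge1$ and $x\in\mathbb{Z}$, $w_m(x)=(1-q)^m\binom{x+m-1}{x}q^xH(x)$ (the negative binomial distribution, i.e. the $m$-fold convolution of $(1-q)q^xH(x)$ with itself). Difference operators: for $f:\mathbb{Z}\to\mathbb{C}$, $\Delta f(x)=f(x+1)-f(x)$, $\Delta^0f=f$, and $(\Delta^{-1}f)(x)=\sum_{y=-\infty}^{x-1}f(y)$ whenever the sum converges; $\Delta^k$ for $k>0$ and $\Delta^{-k}$ for $k>0$ denote the $k$-fold iterates of $\Delta$ and $\Delta^{-1}$ respectively. *)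

theory Defs
  imports "HOL-Probability.Probability" "Jordan_Normal_Form.Determinant"
begin

definition up_right_step :: "nat \<times> nat \<Rightarrow> nat \<times> nat \<Rightarrow> bool" where
  "up_right_step = (\<lambda>(a, b) (c, d). (c, d) = (a + 1, b) \<or> (c, d) = (a, b + 1))"

definition up_right_paths :: "nat \<Rightarrow> nat \<Rightarrow> (nat \<times> nat) list set" where
  "up_right_paths m n =
     {p. p \<noteq> [] \<and> hd p = (1, 1) \<and> last p = (m, n) \<and> successively up_right_step p}"

definition last_passage :: "(nat \<Rightarrow> nat \<Rightarrow> nat) \<Rightarrow> nat \<Rightarrow> nat \<Rightarrow> nat" where
  "last_passage w m n = Max ((\<lambda>p. \<Sum>(i, j)\<leftarrow>p. w i j) ` up_right_paths m n)"

definition heaviside :: "int \<Rightarrow> real" where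
  "heaviside x = (if x \<ge> 0 then 1 else 0)"

definition neg_binomial :: "real \<Rightarrow> nat \<Rightarrow> int \<Rightarrow> real" where
  "neg_binomial q m x =
     (1 - q) ^ m * real (nat (x + int m - 1) choose nat x) * q powi x * heaviside x"

definition fdiff :: "(int \<Rightarrow> 'a) \<Rightarrow> int \<Rightarrow> 'a :: real_normed_vector" where
  "fdiff f x = f (x + 1) - f x"

(* The sum of f y over all y \<le> x - 1, as an ordinary (possibly only conditionally convergent)
   series, with the substitution y = x - 1 - k. It is unspecified if the series diverges. *)
definition fdiff_inv :: "(int \<Rightarrow> 'a) \<Rightarrow> int \<Rightarrow> 'a :: real_normed_vector" where
  "fdiff_inv f x = (\<Sum>k. f (x - 1 - int k))"

definition fdiff_pow :: "int \<Rightarrow> (int \<Rightarrow> 'a) \<Rightarrow> int \<Rightarrow> 'a :: real_normed_vector" where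
  "fdiff_pow k f = (if k \<ge> 0 then (fdiff ^^ nat k) f else (fdiff_inv ^^ nat (- k)) f)"

(* The maximum in last_passage is over a finite nonempty set. *)

lemma up_right_paths_cases:
  assumes "p \<in> up_right_paths m n"
  obtains "p = [(1, 1)]"
  | p' where "p = p' @ [(m, n)]" "m > 0" "p' \<in> up_right_paths (m - 1) n"
  | p' where "p = p' @ [(m, n)]" "n > 0" "p' \<in> up_right_paths m (n - 1)"
proof (cases p rule: rev_cases)
  case Nil
  with assms show ?thesis by (simp add: up_right_paths_def)
next
  case (snoc p' z)
  have z: "z = (m, n)" using assms snoc by (simp add: up_right_paths_def)
  show ?thesis
  proof (cases "p' = []")
    case True
    with assms snoc that(1) show ?thesis by (simp add: up_right_paths_def)
  next
    case False
    obtain a b where ab: "last p' = (a, b)" by (cases "last p'")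
    have "up_right_step (a, b) (m, n)" "successively up_right_step p'" "hd p' = (1, 1)"
      using assms snoc z False ab
      by (auto simp: up_right_paths_def successively_append_iff)
    then show ?thesis
      using that(2,3)[of p'] snoc z False ab by (auto simp: up_right_step_def up_right_paths_def)
  qed
qed

lemma finite_up_right_paths: "finite (up_right_paths m n)"
proof (induction "m + n" arbitrary: m n rule: less_induct)
  case less
  let ?A = "if m > 0 then up_right_paths (m - 1) n else {}"
  let ?B = "if n > 0 then up_right_paths m (n - 1) else {}"
  have "up_right_paths m n \<subseteq> {[(1, 1)]} \<union> (\<lambda>p. p @ [(m, n)]) ` (?A \<union> ?B)"
  proof
    fix p assume "p \<in> up_right_paths m n"
    then show "p \<in> {[(1, 1)]} \<union> (\<lambda>p. p @ [(m, n)]) ` (?A \<union> ?B)"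
      by (rule up_right_paths_cases) simp_all
  qed
  moreover have "finite ?A" "finite ?B" using less by simp_all
  then have "finite ({[(1, 1)]} \<union> (\<lambda>p. p @ [(m, n)]) ` (?A \<union> ?B))" by blast
  ultimately show ?case by (rule finite_subset)
qed

lemma up_right_paths_snoc:
  assumes "p \<in> up_right_paths a b" "up_right_step (a, b) (c, d)"
  shows "p @ [(c, d)] \<in> up_right_paths c d"
  using assms by (auto simp: up_right_paths_def successively_append_iff)

lemma up_right_paths_nonempty: "up_right_paths (Suc m) (Suc n) \<noteq> {}"
proof (induction m)
  case 0
  show ?case
  proof (induction n)
    case 0
    have "[(1, 1)] \<in> up_right_paths 1 1" by (simp add: up_right_paths_def)
    then show ?case by auto
  next
    case (Suc n)
    then obtain p where "p \<in> up_right_paths (Suc 0) (Suc n)" by blast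
    then have "p @ [(Suc 0, Suc (Suc n))] \<in> up_right_paths (Suc 0) (Suc (Suc n))"
      by (rule up_right_paths_snoc) (simp add: up_right_step_def)
    then show ?case by blast
  qed
next
  case (Suc m)
  then obtain p where "p \<in> up_right_paths (Suc m) (Suc n)" by blast
  then have "p @ [(Suc (Suc m), Suc n)] \<in> up_right_paths (Suc (Suc m)) (Suc n)"
    by (rule up_right_paths_snoc) (simp add: up_right_step_def)
  then show ?case by blast
qed

end

theory Submission imports Defs begin

text \<open>
  Write \<open>G(m, n)\<close> for the last-passage time. The determinant is the solution of a linear
  recursion that the joint distribution functions of last-passage times also satisfy; comparing
  distribution functions avoids all summation of transition probabilities. Positions \<open>l\<close> run
  from 0 to \<open>n - 1\<close>. For a time vector \<open>t\<close> of the form \<open>(m + 1, \<dots>, m + 1, m, \<dots>, m)\<close> put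
    \<^item> \<open>F t y = P(G(t\<^sub>l, l + 1) \<le> y\<^sub>l for all l)\<close> (\<open>passage_cdf\<close>),
    \<^item> \<open>D t y = det (\<Delta>\<^bsup>j-i-1\<^esup> w\<^bsub>t(j)\<^esub> (y\<^sub>j + 1))\<close> (\<open>diff_det\<close>).
  The claim is \<open>F t y = D t y\<close> for all weakly increasing \<open>y\<close>; a constant \<open>y\<close> and a constant
  \<open>t\<close> give the theorem, because \<open>G(m, l)\<close> increases with \<open>l\<close>.

  Let \<open>t'\<close> arise from \<open>t\<close> by raising the first entry \<open>m\<close>, at position \<open>j\<close>, to \<open>m + 1\<close>, and let
  \<open>e\<^sub>j\<close> be the unit vector at that position. Both functions satisfy
  \<open>X t' y = q X t' (y - e\<^sub>j) + (1 - q) X t y\<close>. For \<open>F\<close> this is the memoryless property of the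
  one weight that enters (\<open>passage_cdf_step\<close>); for \<open>D\<close> it is the same identity for the negative
  binomial weights in column \<open>j\<close> (\<open>diff_det_step\<close>).

  The vector \<open>y - e\<^sub>j\<close> need not be increasing. However, the positions up to \<open>j\<close> all carry the
  time \<open>m + 1\<close> in \<open>t'\<close>, and neither function changes when the earlier entries of \<open>y - e\<^sub>j\<close> are
  cut down to its entry at \<open>j\<close>. For \<open>F\<close> this is the monotonicity of \<open>G\<close>
  (\<open>passage_cdf_truncate\<close>); for \<open>D\<close> it is a column operation, since neighbouring columns differ
  by one application of \<open>\<Delta>\<close> (\<open>diff_det_truncate\<close>). Cutting down restores monotonicity, so the
  recursion closes on increasing vectors, and it decreases the sum of the entries. Both functions
  vanish once \<open>y\<^sub>0 < 0\<close>. For \<open>t = 0\<close> and increasing \<open>y\<close> with \<open>y\<^sub>0 \<ge> 0\<close> both equal 1, as the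
  matrix is then unitriangular. Hence they agree.
\<close>

section \<open>Iterated differences of sequences supported on the nonnegative integers\<close>

lemma fdiff_inv_eq_0:
  assumes "\<And>y. y < a \<Longrightarrow> f y = 0" "x \<le> a"
  shows "fdiff_inv f x = 0"
  using assms by (simp add: fdiff_inv_def)

lemma fdiff_fdiff_inv:
  assumes "\<And>y. y < a \<Longrightarrow> f y = 0"
  shows "fdiff (fdiff_inv f) = f"
proof
  fix x
  have "summable (\<lambda>k. f (x - int k))"
    by (rule summable_finite[of "{..nat (x - a)}"]) (auto intro!: assms)
  from suminf_split_head[OF this]
  have "(\<Sum>k. f (x - int (Suc k))) = (\<Sum>k. f (x - int k)) - f x"
    by simp
  then show "fdiff (fdiff_inv f) x = f x"
    by (simp add: fdiff_def fdiff_inv_def algebra_simps)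
qed

lemma funpow_fdiff_inv_eq_0:
  assumes "\<And>y. y < 0 \<Longrightarrow> f y = 0" "x < 0"
  shows "(fdiff_inv ^^ k) f x = 0"
  using assms(2)
proof (induction k arbitrary: x)
  case 0
  then show ?case using assms(1) by simp
next
  case (Suc k)
  then show ?case by (auto intro!: fdiff_inv_eq_0[of 0])
qed

lemma fdiff_pow_neg_eq_0:
  assumes "\<And>y. y < 0 \<Longrightarrow> f y = 0" "k < 0" "x \<le> 0"
  shows "fdiff_pow k f x = 0"
proof -
  obtain j where "nat (- k) = Suc j"
    using assms(2) by (metis gr0_implies_Suc neg_0_less_iff_less zero_less_nat_eq)
  then show ?thesis
    using assms by (auto simp: fdiff_pow_def intro!: fdiff_inv_eq_0[of 0] funpow_fdiff_inv_eq_0)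
qed

text \<open>
  For a sequence that vanishes on the negative integers, the two halves of the definition of
  \<^const>\<open>fdiff_pow\<close> join into one family indexed by the integers.
\<close>
lemma fdiff_pow_add_1:
  assumes "\<And>y. y < 0 \<Longrightarrow> f y = 0"
  shows "fdiff_pow (k + 1) f = fdiff (fdiff_pow k f)"
proof (cases "k \<ge> 0")
  case True
  then show ?thesis by (simp add: fdiff_pow_def nat_add_distrib)
next
  case False
  define j where "j = nat (- k - 1)"
  have k: "k = - int (Suc j)" using False by (simp add: j_def)
  have "fdiff_pow (k + 1) f = (fdiff_inv ^^ j) f"
    by (cases j) (simp_all add: k fdiff_pow_def nat_add_distrib)
  moreover have "fdiff_pow k f = fdiff_inv ((fdiff_inv ^^ j) f)"
    by (simp add: k fdiff_pow_def nat_add_distrib)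
  moreover have "fdiff (fdiff_inv ((fdiff_inv ^^ j) f)) = (fdiff_inv ^^ j) f"
    by (rule fdiff_fdiff_inv[of 0]) (rule funpow_fdiff_inv_eq_0[OF assms])
  ultimately show ?thesis by simp
qed

corollary fdiff_pow_shift:
  assumes "\<And>y. y < 0 \<Longrightarrow> f y = 0"
  shows "fdiff_pow k f (x + 1) = fdiff_pow k f x + fdiff_pow (k + 1) f x"
  by (simp add: fdiff_pow_add_1[OF assms] fdiff_def)

lemma fdiff_pow_nonneg_eq_0:
  assumes f: "\<And>y. y < 0 \<Longrightarrow> f y = 0" and pos: "\<And>y. y > 0 \<Longrightarrow> f y = 0"
    and "k \<ge> 0" "x > 0"
  shows "fdiff_pow k f x = 0"
  using \<open>k \<ge> 0\<close> \<open>x > 0\<close>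
proof (induction k arbitrary: x rule: int_ge_induct)
  case base
  then show ?case using pos by (simp add: fdiff_pow_def)
next
  case (step k)
  then show ?case by (simp add: fdiff_pow_add_1[OF f] fdiff_def)
qed

text \<open>
  First-order recursions with constant coefficients commute with all powers of \<open>\<Delta>\<close>. Downwards
  in \<open>k\<close>, the discrepancy has difference zero and vanishes on the negative integers, hence
  everywhere; this avoids manipulating the infinite sums.
\<close>
lemma fdiff_pow_recursion:
  fixes f g :: "int \<Rightarrow> real"
  assumes f: "\<And>y. y < 0 \<Longrightarrow> f y = 0" and g: "\<And>y. y < 0 \<Longrightarrow> g y = 0"
    and rec: "\<And>x. f x = q * f (x - 1) + c * g x"
  shows "fdiff_pow k f x = q * fdiff_pow k f (x - 1) + c * fdiff_pow k g x"
proof (induction k arbitrary: x rule: int_induct[where k = 0])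
  case base
  show ?case by (simp add: fdiff_pow_def) (rule rec)
next
  case (step1 k)
  have "fdiff_pow (k + 1) f x = fdiff_pow k f (x + 1) - fdiff_pow k f x"
    "fdiff_pow (k + 1) f (x - 1) = fdiff_pow k f x - fdiff_pow k f (x - 1)"
    "fdiff_pow (k + 1) g x = fdiff_pow k g (x + 1) - fdiff_pow k g x"
    by (simp_all add: fdiff_pow_add_1[OF f] fdiff_pow_add_1[OF g] fdiff_def)
  then show ?case
    using step1(2)[of "x + 1"] step1(2)[of x] by (simp only:) (simp add: algebra_simps)
next
  case (step2 k)
  define d where
    "d x = fdiff_pow (k - 1) f x - q * fdiff_pow (k - 1) f (x - 1) - c * fdiff_pow (k - 1) g x" for x
  have neg: "d x = 0" if "x \<le> 0" for x
    using that step2(1) by (simp add: d_def fdiff_pow_neg_eq_0 f g)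
  have d_Suc: "d (x + 1) = d x" for x
    using step2(2)[of x] fdiff_pow_shift[of f "k - 1" x, OF f]
      fdiff_pow_shift[of f "k - 1" "x - 1", OF f] fdiff_pow_shift[of g "k - 1" x, OF g]
    by (simp add: d_def algebra_simps)
  have "d x = 0"
  proof (cases "x \<ge> 0")
    case True
    then show ?thesis
      by (induction x rule: int_ge_induct) (simp_all add: neg d_Suc)
  qed (simp add: neg)
  then show ?case by (simp add: d_def)
qed

lemma neg_binomial_neg: "x < 0 \<Longrightarrow> neg_binomial q m x = 0"
  by (simp add: neg_binomial_def heaviside_def)

lemma neg_binomial_0: "neg_binomial q 0 x = (if x = 0 then 1 else 0)"
  by (auto simp: neg_binomial_def heaviside_def nat_less_iff binomial_eq_0)

text \<open>Convolution with the geometric distribution, in the form of Pascal's rule.\<close>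
lemma neg_binomial_recursion:
  assumes "q \<noteq> 0"
  shows "neg_binomial q (Suc m) x = q * neg_binomial q (Suc m) (x - 1) + (1 - q) * neg_binomial q m x"
proof (cases "x \<le> 0")
  case True
  then show ?thesis by (cases "x = 0") (simp_all add: neg_binomial_def heaviside_def)
next
  case False
  then obtain k where x: "x = int (Suc k)" by (metis gr0_implies_Suc not_less zero_less_imp_eq_int)
  have "nat (x + int (Suc m) - 1) = Suc (k + m)" "nat (x - 1 + int (Suc m) - 1) = k + m"
    "nat (x + int m - 1) = k + m" "nat x = Suc k" "nat (x - 1) = k"
    using x by simp_all
  moreover have "q powi x = q ^ Suc k" "q powi (x - 1) = q ^ k"
    unfolding x by (simp_all flip: power_int_of_nat)
  ultimately show ?thesis
    using x by (simp add: neg_binomial_def heaviside_def algebra_simps)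
qed

section \<open>The determinant\<close>

definition diff_det :: "real \<Rightarrow> nat \<Rightarrow> (nat \<Rightarrow> nat) \<Rightarrow> (nat \<Rightarrow> int) \<Rightarrow> real" where
  "diff_det q n t y = Determinant.det (Matrix.mat n n
     (\<lambda>(i, j). fdiff_pow (int j - int i - 1) (neg_binomial q (t j)) (y j + 1)))"

lemma diff_det_cong:
  assumes "\<And>j. j < n \<Longrightarrow> t j = t' j" "\<And>j. j < n \<Longrightarrow> y j = y' j"
  shows "diff_det q n t y = diff_det q n t' y'"
  unfolding diff_det_def using assms
  by (intro arg_cong[where f = Determinant.det] eq_matI) simp_all

lemma det_column_linear:
  fixes A B C :: "nat \<times> nat \<Rightarrow> 'a :: comm_ring_1"
  assumes k: "k < n"
    and col: "\<And>i. i < n \<Longrightarrow> A (i, k) = a * B (i, k) + b * C (i, k)"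
    and B: "\<And>i j. i < n \<Longrightarrow> j < n \<Longrightarrow> j \<noteq> k \<Longrightarrow> B (i, j) = A (i, j)"
    and C: "\<And>i j. i < n \<Longrightarrow> j < n \<Longrightarrow> j \<noteq> k \<Longrightarrow> C (i, j) = A (i, j)"
  shows "Determinant.det (Matrix.mat n n A) =
    a * Determinant.det (Matrix.mat n n B) + b * Determinant.det (Matrix.mat n n C)"
proof -
  have cof: "cofactor (Matrix.mat n n X) i k = cofactor (Matrix.mat n n A) i k"
    if i: "i < n" and X: "\<And>i j. i < n \<Longrightarrow> j < n \<Longrightarrow> j \<noteq> k \<Longrightarrow> X (i, j) = A (i, j)" for X i
    unfolding cofactor_def mat_delete_def
    by (intro arg_cong2[where f = "(*)"] refl arg_cong[where f = Determinant.det] eq_matI)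
      (auto intro!: X)
  have exp: "Determinant.det (Matrix.mat n n X) =
      (\<Sum>i<n. X (i, k) * cofactor (Matrix.mat n n X) i k)" for X :: "nat \<times> nat \<Rightarrow> 'a"
    using k by (subst laplace_expansion_column[OF _ k]) simp_all
  have "cofactor (Matrix.mat n n B) i k = cofactor (Matrix.mat n n A) i k"
    "cofactor (Matrix.mat n n C) i k = cofactor (Matrix.mat n n A) i k" if "i < n" for i
    using that by (auto intro!: cof B C)
  then show ?thesis
    by (simp add: exp col sum_distrib_left sum.distrib algebra_simps)
qed

text \<open>
  The recursion of the distribution functions with one additional weight, read off from the
  column that changes.
\<close>
lemma diff_det_step:
  assumes "q \<noteq> 0" "j < n"
    and t: "t' j = Suc (t j)" "\<And>i. i \<noteq> j \<Longrightarrow> t' i = t i"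
  shows "diff_det q n t' y = q * diff_det q n t' (y(j := y j - 1)) + (1 - q) * diff_det q n t y"
  unfolding diff_det_def
proof (rule det_column_linear[OF \<open>j < n\<close>], goal_cases)
  case (1 i)
  show ?case
    using fdiff_pow_recursion[where f = "neg_binomial q (Suc (t j))" and g = "neg_binomial q (t j)"
        and k = "int j - int i - 1" and x = "y j + 1", OF neg_binomial_neg neg_binomial_neg neg_binomial_recursion[OF \<open>q \<noteq> 0\<close>]]
    by (simp add: t)
qed (simp_all add: t)

text \<open>
  Column \<open>l + 1\<close> is \<open>\<Delta>\<close> applied to the function whose values form column \<open>l\<close>. When the
  argument of column \<open>l\<close> is one larger than that of column \<open>l + 1\<close>, replacing it by the
  smaller argument therefore subtracts column \<open>l + 1\<close> from column \<open>l\<close>.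
\<close>
lemma diff_det_lower:
  assumes l: "Suc l < n" and t: "t l = t (Suc l)" and y: "y l = y (Suc l) + 1"
  shows "diff_det q n t y = diff_det q n t (y(l := y (Suc l)))"
proof -
  let ?A = "\<lambda>y (i, j). fdiff_pow (int j - int i - 1) (neg_binomial q (t j)) (y j + 1)"
  \<comment> \<open>Column \<open>l\<close> is overwritten by column \<open>l + 1\<close>.\<close>
  let ?B = "\<lambda>(i, j). ?A y (i, if j = l then Suc l else j)"
  have "Determinant.det (Matrix.mat n n ?B) = 0"
    using l by (intro det_identical_columns[of _ n l "Suc l"]) (auto simp: Matrix.col_def)
  moreover have "Determinant.det (Matrix.mat n n (?A y)) =
      1 * Determinant.det (Matrix.mat n n (?A (y(l := y (Suc l))))) +
      1 * Determinant.det (Matrix.mat n n ?B)"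
  proof (rule det_column_linear[of l], goal_cases)
    case (2 i)
    show ?case
      using fdiff_pow_shift[of "neg_binomial q (t (Suc l))" "int l - int i - 1" "y (Suc l) + 1"]
      by (simp add: t y neg_binomial_neg algebra_simps)
  qed (use l in simp_all)
  ultimately show ?thesis by (simp add: diff_det_def)
qed

definition truncate_below :: "nat \<Rightarrow> (nat \<Rightarrow> int) \<Rightarrow> nat \<Rightarrow> int" where
  "truncate_below j y = (\<lambda>i. if i \<le> j then min (y i) (y j) else y i)"

text \<open>
  Entries before \<open>j\<close> exceed \<open>y j\<close> by at most one. The excess is removed first at \<open>j - 1\<close>,
  where \<open>diff_det_lower\<close> applies; this creates the same situation one position further left.
\<close>
lemma diff_det_truncate:
  assumes "j < n" "\<And>i. i < j \<Longrightarrow> t i = t j"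
    and "\<And>i k. i \<le> k \<Longrightarrow> k < j \<Longrightarrow> y i \<le> y k" "\<And>i. i < j \<Longrightarrow> y i \<le> y j + 1"
  shows "diff_det q n t y = diff_det q n t (truncate_below j y)"
  using assms
proof (induction j arbitrary: y)
  case 0
  have "truncate_below 0 y = y" by (simp add: truncate_below_def fun_eq_iff)
  then show ?case by simp
next
  case (Suc j)
  show ?case
  proof (cases "y j \<le> y (Suc j)")
    case True
    have "y i \<le> y (Suc j)" if "i \<le> j" for i
      using Suc.prems(3)[of i j] that True by simp
    then have "truncate_below (Suc j) y = y"
      by (auto simp: truncate_below_def fun_eq_iff min_def le_Suc_eq)
    then show ?thesis by simp
  next
    case False
    with Suc.prems(4)[of j] have eq: "y j = y (Suc j) + 1" by simp
    let ?y = "y(j := y (Suc j))"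
    have le: "y i \<le> y j" if "i \<le> j" for i
      using Suc.prems(3)[of i j] that by simp
    have "diff_det q n t y = diff_det q n t ?y"
      using Suc.prems eq by (intro diff_det_lower) simp_all
    also have "\<dots> = diff_det q n t (truncate_below j ?y)"
    proof (rule Suc.IH)
      show "t i = t j" if "i < j" for i
        using Suc.prems(2)[of i] Suc.prems(2)[of j] that by simp
      show "?y i \<le> ?y j + 1" if "i < j" for i
        using le[of i] eq that by simp
    qed (use Suc.prems in simp_all)
    also have "truncate_below j ?y = truncate_below (Suc j) y"
      using eq by (auto simp: truncate_below_def fun_eq_iff le_Suc_eq)
    finally show ?thesis .
  qed
qed

lemma diff_det_eq_0:
  assumes "0 < n" "y 0 < 0"
  shows "diff_det q n t y = 0"
proof -
  let ?A = "\<lambda>(i, j). fdiff_pow (int j - int i - 1) (neg_binomial q (t j)) (y j + 1)"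
  have "Determinant.det (Matrix.mat n n ?A) =
      0 * Determinant.det (Matrix.mat n n ?A) + 0 * Determinant.det (Matrix.mat n n ?A)"
    by (rule det_column_linear[OF assms(1)])
      (use assms in \<open>simp_all add: fdiff_pow_neg_eq_0 neg_binomial_neg\<close>)
  then show ?thesis by (simp add: diff_det_def)
qed

text \<open>
  For \<open>t = 0\<close> the weight is the point mass at the origin. Its differences vanish to the right of
  the origin, and its first antidifference is 1 there, so the matrix is lower unitriangular.
\<close>
lemma diff_det_time_0:
  assumes "\<And>j. j < n \<Longrightarrow> y j \<ge> 0"
  shows "diff_det q n (\<lambda>_. 0) y = 1"
proof -
  have van: "\<And>x. x < 0 \<Longrightarrow> neg_binomial q 0 x = 0" by (rule neg_binomial_neg)
  have one: "fdiff_pow (- 1) (neg_binomial q 0) (x + 1) = 1" if "x \<ge> 0" for x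
    using that
  proof (induction x rule: int_ge_induct)
    case base
    show ?case
      using fdiff_pow_shift[OF van, where k = "- 1" and x = 0]
        fdiff_pow_neg_eq_0[OF van, where k = "- 1" and x = 0]
      by (simp add: fdiff_pow_def neg_binomial_0)
  next
    case (step x)
    then show ?case
      using fdiff_pow_shift[OF van, where k = "- 1" and x = "x + 1"]
      by (simp add: fdiff_pow_def[of 0] neg_binomial_0)
  qed
  show ?thesis
    unfolding diff_det_def
  proof (subst det_lower_triangular[of n])
    show "Matrix.mat n n (\<lambda>(i, j). fdiff_pow (int j - int i - 1) (neg_binomial q 0) (y j + 1)) $$ (i, j) = 0"
      if "i < j" "j < n" for i j
      using that assms[of j] by (simp add: fdiff_pow_nonneg_eq_0 neg_binomial_0)
  qed (simp_all add: prod_list_diag_prod one assms)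
qed

section \<open>Last-passage times\<close>

fun passage :: "(nat \<Rightarrow> nat \<Rightarrow> nat) \<Rightarrow> nat \<Rightarrow> nat \<Rightarrow> nat" where
  "passage u 0 j = 0"
| "passage u (Suc i) 0 = 0"
| "passage u (Suc i) (Suc j) = max (passage u i (Suc j)) (passage u (Suc i) j) + u (Suc i) (Suc j)"

lemma passage_0_right [simp]: "passage u i 0 = 0"
  by (cases i) simp_all

lemma passage_cong:
  assumes "\<And>a b. 1 \<le> a \<Longrightarrow> a \<le> i \<Longrightarrow> 1 \<le> b \<Longrightarrow> b \<le> j \<Longrightarrow> u a b = v a b"
  shows "passage u i j = passage v i j"
  using assms
proof (induction u i j rule: passage.induct)
  case (3 u i j)
  have "passage u i (Suc j) = passage v i (Suc j)" "passage u (Suc i) j = passage v (Suc i) j"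
    using 3 by simp_all
  then show ?case using 3(3)[of "Suc i" "Suc j"] by simp
qed simp_all

lemma passage_mono_right:
  assumes "j \<le> j'"
  shows "passage u i j \<le> passage u i j'"
proof (cases i)
  case (Suc i')
  show ?thesis
    by (rule lift_Suc_mono_le[OF _ assms]) (simp add: Suc)
qed simp

lemma path_weight_le_passage:
  assumes "p \<in> up_right_paths i j"
  shows "(\<Sum>(a, b)\<leftarrow>p. u a b) \<le> passage u i j \<and> 1 \<le> i \<and> 1 \<le> j"
  using assms
proof (induction "i + j" arbitrary: i j p rule: less_induct)
  case less
  from less.prems show ?case
  proof (cases rule: up_right_paths_cases)
    case 1
    with less.prems show ?thesis by (auto simp: up_right_paths_def)
  next
    case (2 p')
    with less.hyps[of "i - 1" j p'] show ?thesis by (cases i; cases j) auto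
  next
    case (3 p')
    with less.hyps[of i "j - 1" p'] show ?thesis by (cases i; cases j) auto
  qed
qed

lemma passage_attained:
  "\<exists>p \<in> up_right_paths (Suc i) (Suc j). (\<Sum>(a, b)\<leftarrow>p. u a b) = passage u (Suc i) (Suc j)"
proof (induction "i + j" arbitrary: i j rule: less_induct)
  case less
  have snoc: ?case
    if "p \<in> up_right_paths a b" "(\<Sum>(a, b)\<leftarrow>p. u a b) = max (passage u i (Suc j)) (passage u (Suc i) j)"
      "up_right_step (a, b) (Suc i, Suc j)" for p a b
    using up_right_paths_snoc[OF that(1,3)] that(2)
    by (intro bexI[of _ "p @ [(Suc i, Suc j)]"]) simp_all
  have left: ?case if i: "i > 0" and le: "passage u (Suc i) j \<le> passage u i (Suc j)"
  proof -
    from i obtain i' where i': "i = Suc i'" by (cases i) auto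
    with less.hyps[of i' j] obtain p where
      "p \<in> up_right_paths i (Suc j)" "(\<Sum>(a, b)\<leftarrow>p. u a b) = passage u i (Suc j)"
      by auto
    then show ?thesis using le by (intro snoc[of p i "Suc j"]) (simp_all add: up_right_step_def)
  qed
  have down: ?case if j: "j > 0" and le: "passage u i (Suc j) \<le> passage u (Suc i) j"
  proof -
    from j obtain j' where j': "j = Suc j'" by (cases j) auto
    with less.hyps[of i j'] obtain p where
      "p \<in> up_right_paths (Suc i) j" "(\<Sum>(a, b)\<leftarrow>p. u a b) = passage u (Suc i) j"
      by auto
    then show ?thesis using le by (intro snoc[of p "Suc i" j]) (simp_all add: up_right_step_def)
  qed
  consider "i = 0" "j = 0" | "i > 0" "passage u (Suc i) j \<le> passage u i (Suc j)"
    | "j > 0" "passage u i (Suc j) \<le> passage u (Suc i) j"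
    by (cases "i = 0"; cases "j = 0"; cases "passage u (Suc i) j \<le> passage u i (Suc j)") auto
  then show ?case
  proof cases
    case 1
    have "[(1, 1)] \<in> up_right_paths 1 1" by (simp add: up_right_paths_def)
    with 1 show ?thesis by (intro bexI[of _ "[(1, 1)]"]) simp_all
  qed (use left down in blast)+
qed

lemma last_passage_eq_passage:
  assumes "m \<ge> 1" "n \<ge> 1"
  shows "last_passage u m n = passage u m n"
proof -
  obtain i j where ij: "m = Suc i" "n = Suc j" using assms by (metis Suc_le_D One_nat_def)
  show ?thesis
    unfolding last_passage_def
  proof (rule Max_eqI)
    show "finite ((\<lambda>p. \<Sum>(i, j)\<leftarrow>p. u i j) ` up_right_paths m n)"
      by (intro finite_imageI finite_up_right_paths)
    show "passage u m n \<in> (\<lambda>p. \<Sum>(i, j)\<leftarrow>p. u i j) ` up_right_paths m n"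
      using passage_attained[of i j u] by (auto simp: ij image_iff intro: sym)
  qed (use path_weight_le_passage in blast)
qed

section \<open>Joint distribution of last-passage times\<close>

locale geometric_weights = prob_space M for M :: "'a measure" +
  fixes w :: "nat \<Rightarrow> nat \<Rightarrow> 'a \<Rightarrow> nat" and q :: real
  assumes q_pos: "0 < q"
    and indep: "indep_vars (\<lambda>_. count_space UNIV) (\<lambda>(i, j). w i j) ({1..} \<times> {1..})"
    and geometric: "\<And>i j k. i \<ge> 1 \<Longrightarrow> j \<ge> 1 \<Longrightarrow>
           prob {\<omega> \<in> space M. w i j \<omega> = k} = (1 - q) * q ^ k"
begin

abbreviation weights :: "'a \<Rightarrow> nat \<Rightarrow> nat \<Rightarrow> nat" where
  "weights \<omega> \<equiv> \<lambda>i j. w i j \<omega>"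

text \<open>
  Finitely many weights take values in a countable discrete space, so every predicate \<open>Q\<close> of
  them defines an event.
\<close>
lemma weight_event:
  assumes K: "finite K" "K \<subseteq> {1..} \<times> {1..}" and ab: "(a, b) \<notin> K" "a \<ge> 1" "b \<ge> 1"
    and Q: "\<And>u v. (\<And>i j. (i, j) \<in> K \<Longrightarrow> u i j = v i j) \<Longrightarrow> Q u = Q v"
  shows weight_event_sets: "{\<omega> \<in> space M. Q (weights \<omega>) \<and> w a b \<omega> = k} \<in> events"
    and weight_event_indep: "prob {\<omega> \<in> space M. Q (weights \<omega>) \<and> w a b \<omega> = k} =
      prob {\<omega> \<in> space M. Q (weights \<omega>)} * ((1 - q) * q ^ k)"
proof -
  let ?X = "\<lambda>(i, j). w i j" and ?C = "\<lambda>_ :: nat \<times> nat. count_space (UNIV :: nat set)"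
  let ?Y = "\<lambda>L \<omega>. restrict (\<lambda>p. ?X p \<omega>) L"
  have ind: "indep_var (PiM K ?C) (?Y K) (PiM {(a, b)} ?C) (?Y {(a, b)})"
    by (rule indep_var_restrict[OF indep]) (use K ab in auto)
  define S where "S = {f \<in> PiE K (\<lambda>_. UNIV). Q (\<lambda>i j. f (i, j))}"
  define T :: "(nat \<times> nat \<Rightarrow> nat) set" where "T = {f \<in> PiE {(a, b)} (\<lambda>_. UNIV). f (a, b) = k}"
  have S: "S \<in> sets (PiM K ?C)" and T: "T \<in> sets (PiM {(a, b)} ?C)"
    using K by (auto simp: count_space_PiM_finite S_def T_def)
  have Q_eq: "Q (\<lambda>i j. ?Y K \<omega> (i, j)) = Q (weights \<omega>)" for \<omega>
    by (rule Q) simp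
  have S_eq: "?Y K -` S \<inter> space M = {\<omega> \<in> space M. Q (weights \<omega>)}"
    using Q_eq by (auto simp: S_def)
  have T_eq: "?Y {(a, b)} -` T \<inter> space M = {\<omega> \<in> space M. w a b \<omega> = k}"
    by (auto simp: T_def)
  have ST_eq: "(\<lambda>x. (?Y K x, ?Y {(a, b)} x)) -` (S \<times> T) \<inter> space M =
      {\<omega> \<in> space M. Q (weights \<omega>) \<and> w a b \<omega> = k}"
    using S_eq T_eq by auto
  have "?Y K \<in> measurable M (PiM K ?C)" "?Y {(a, b)} \<in> measurable M (PiM {(a, b)} ?C)"
    using ind by (auto simp: indep_var_eq)
  then have "?Y K -` S \<inter> space M \<in> events" "?Y {(a, b)} -` T \<inter> space M \<in> events"
    using S T by (auto intro: measurable_sets)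
  then have "(?Y K -` S \<inter> space M) \<inter> (?Y {(a, b)} -` T \<inter> space M) \<in> events"
    by (rule sets.Int)
  also have "(?Y K -` S \<inter> space M) \<inter> (?Y {(a, b)} -` T \<inter> space M) =
      {\<omega> \<in> space M. Q (weights \<omega>) \<and> w a b \<omega> = k}"
    unfolding S_eq T_eq by auto
  finally show "{\<omega> \<in> space M. Q (weights \<omega>) \<and> w a b \<omega> = k} \<in> events" .
  show "prob {\<omega> \<in> space M. Q (weights \<omega>) \<and> w a b \<omega> = k} =
      prob {\<omega> \<in> space M. Q (weights \<omega>)} * ((1 - q) * q ^ k)"
    using indep_varD[OF ind S T] geometric[OF ab(2,3), of k] by (simp only: ST_eq S_eq T_eq)
qed

text \<open>
  Conditionally on \<open>w a b > 0\<close>, which has probability \<open>q\<close>, the variable \<open>w a b - 1\<close> is again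
  geometric: the event \<open>w a b = 0\<close> contributes the second summand, its complement the first one.
\<close>
lemma memoryless:
  fixes U :: "(nat \<Rightarrow> nat \<Rightarrow> nat) \<Rightarrow> nat" and y :: int
  assumes K: "finite K" "K \<subseteq> {1..} \<times> {1..}" and ab: "(a, b) \<notin> K" "a \<ge> 1" "b \<ge> 1"
    and B: "\<And>u v. (\<And>i j. (i, j) \<in> K \<Longrightarrow> u i j = v i j) \<Longrightarrow> B u = B v"
    and U: "\<And>u v. (\<And>i j. (i, j) \<in> K \<Longrightarrow> u i j = v i j) \<Longrightarrow> U u = U v"
  shows "prob {\<omega> \<in> space M. B (weights \<omega>) \<and> int (U (weights \<omega>) + w a b \<omega>) \<le> y} =
    q * prob {\<omega> \<in> space M. B (weights \<omega>) \<and> int (U (weights \<omega>) + w a b \<omega>) \<le> y - 1} +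
    (1 - q) * prob {\<omega> \<in> space M. B (weights \<omega>) \<and> int (U (weights \<omega>)) \<le> y}"
proof -
  define E where "E y = prob {\<omega> \<in> space M. B (weights \<omega>) \<and> int (U (weights \<omega>) + w a b \<omega>) \<le> y}" for y
  define A where "A y = prob {\<omega> \<in> space M. B (weights \<omega>) \<and> int (U (weights \<omega>)) \<le> y}" for y
  have E_sum: "E y = (\<Sum>k<nat (y + 1). A (y - int k) * ((1 - q) * q ^ k))" for y
  proof -
    let ?Q = "\<lambda>k u. B u \<and> int (U u) \<le> y - int k"
    let ?e = "\<lambda>k. {\<omega> \<in> space M. ?Q k (weights \<omega>) \<and> w a b \<omega> = k}"
    have Q: "?Q k u = ?Q k v" if "\<And>i j. (i, j) \<in> K \<Longrightarrow> u i j = v i j" for k u v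
      using B[of u v] U[of u v] that by simp
    have "{\<omega> \<in> space M. B (weights \<omega>) \<and> int (U (weights \<omega>) + w a b \<omega>) \<le> y} =
        (\<Union>k<nat (y + 1). ?e k)"
      by auto
    also have "prob \<dots> = (\<Sum>k<nat (y + 1). prob (?e k))"
    proof (rule finite_measure_finite_Union)
      have "?e k \<in> events" for k
        by (rule weight_event_sets[OF K ab Q])
      then show "?e ` {..<nat (y + 1)} \<subseteq> events" by blast
    qed (auto simp: disjoint_family_on_def)
    also have "\<dots> = (\<Sum>k<nat (y + 1). A (y - int k) * ((1 - q) * q ^ k))"
      unfolding A_def by (intro sum.cong refl weight_event_indep[OF K ab Q])
    finally show ?thesis by (simp add: E_def)
  qed
  have "E y = q * E (y - 1) + (1 - q) * A y"
  proof (cases "y < 0")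
    case True
    have "A y = 0" using True by (simp add: A_def)
    with True show ?thesis by (simp add: E_sum)
  next
    case False
    \<comment> \<open>The term for \<open>k = 0\<close> is \<open>(1 - q) A y\<close>; shifting the index turns the others into \<open>q E (y - 1)\<close>.\<close>
    then have "nat (y + 1) = Suc (nat y)" by simp
    then show ?thesis
      by (simp add: E_sum sum.lessThan_Suc_shift sum_distrib_left algebra_simps del: sum.lessThan_Suc)
  qed
  then show ?thesis by (simp add: E_def A_def)
qed

definition passage_cdf :: "nat \<Rightarrow> (nat \<Rightarrow> nat) \<Rightarrow> (nat \<Rightarrow> int) \<Rightarrow> real" where
  "passage_cdf n t y =
     prob {\<omega> \<in> space M. \<forall>l<n. int (passage (weights \<omega>) (t l) (Suc l)) \<le> y l}"

lemma passage_cdf_cong: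
  assumes "\<And>l. l < n \<Longrightarrow> t l = t' l"
  shows "passage_cdf n t y = passage_cdf n t' y"
  using assms by (simp add: passage_cdf_def cong: conj_cong)

lemma passage_cdf_eq_0:
  assumes "0 < n" "y 0 < 0"
  shows "passage_cdf n t y = 0"
proof -
  have "{\<omega> \<in> space M. \<forall>l<n. int (passage (weights \<omega>) (t l) (Suc l)) \<le> y l} = {}"
    using assms by (force simp: not_le)
  then show ?thesis by (simp only: passage_cdf_def measure_empty)
qed

lemma passage_cdf_time_0:
  assumes "\<And>j. j < n \<Longrightarrow> y j \<ge> 0"
  shows "passage_cdf n (\<lambda>_. 0) y = 1"
  using assms by (simp add: passage_cdf_def prob_space)

lemma passage_cdf_truncate:
  assumes "j < n" "\<And>i. i < j \<Longrightarrow> t i = t j"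
  shows "passage_cdf n t y = passage_cdf n t (truncate_below j y)"
proof -
  have "(\<forall>l<n. int (passage u (t l) (Suc l)) \<le> y l) \<longleftrightarrow>
        (\<forall>l<n. int (passage u (t l) (Suc l)) \<le> truncate_below j y l)" (is "?L \<longleftrightarrow> ?R") for u
  proof
    assume L: ?L
    show ?R
    proof (intro allI impI)
      fix l assume l: "l < n"
      have "int (passage u (t l) (Suc l)) \<le> y j" if "l \<le> j"
      proof -
        have "passage u (t l) (Suc l) \<le> passage u (t j) (Suc j)"
          using that assms(2)[of l] passage_mono_right[of "Suc l" "Suc j" u "t j"]
          by (cases "l = j") simp_all
        with L \<open>j < n\<close> show ?thesis by (meson of_nat_mono order_trans)
      qed
      with L l show "int (passage u (t l) (Suc l)) \<le> truncate_below j y l"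
        by (simp add: truncate_below_def)
    qed
  next
    assume R: ?R
    have "truncate_below j y l \<le> y l" for l by (simp add: truncate_below_def)
    with R show ?L by (meson order_trans)
  qed
  then show ?thesis by (simp add: passage_cdf_def)
qed

definition stair :: "nat \<Rightarrow> nat \<Rightarrow> nat \<Rightarrow> nat" where
  "stair m j = (\<lambda>l. if l < j then Suc m else m)"

text \<open>
  Raising the time at position \<open>j\<close> replaces \<open>G(m, j + 1)\<close> by
  \<open>max (G(m, j + 1)) (G(m + 1, j)) + w(m + 1, j + 1)\<close>, and the new weight is independent of all
  other quantities. For \<open>j > 0\<close>, the bounds at the other positions include
  \<open>G(m + 1, j) \<le> y (j - 1) \<le> y j\<close>, so the maximum exceeds \<open>y j\<close> only if \<open>G(m, j + 1)\<close> does;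
  this is where increasing \<open>y\<close> matters.
\<close>
lemma passage_cdf_step:
  assumes j: "j < n" and y: "mono_on {..<n} y"
  shows "passage_cdf n (stair m (Suc j)) y =
    q * passage_cdf n (stair m (Suc j)) (y(j := y j - 1)) + (1 - q) * passage_cdf n (stair m j) y"
proof -
  define B where
    "B u \<longleftrightarrow> (\<forall>l<n. l \<noteq> j \<longrightarrow> int (passage u (stair m j l) (Suc l)) \<le> y l)" for u
  define U where "U u = max (passage u m (Suc j)) (passage u (Suc m) j)" for u
  let ?K = "{1..Suc m} \<times> {1..n} - {(Suc m, Suc j)}"
  have agree: "passage u a b = passage v a b"
    if "\<And>i k. (i, k) \<in> ?K \<Longrightarrow> u i k = v i k" "a \<le> Suc m" "b \<le> n" "a \<le> m \<or> b \<le> j" for u v a b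
    using that by (intro passage_cong) auto
  have B_cong: "B u = B v" if uv: "\<And>i k. (i, k) \<in> ?K \<Longrightarrow> u i k = v i k" for u v
  proof -
    have "passage u (stair m j l) (Suc l) = passage v (stair m j l) (Suc l)" if "l < n" for l
      using that by (intro agree[OF uv]) (auto simp: stair_def)
    then show ?thesis by (simp add: B_def)
  qed
  have U_cong: "U u = U v" if "\<And>i k. (i, k) \<in> ?K \<Longrightarrow> u i k = v i k" for u v
    using agree[of u v m "Suc j", OF that] agree[of u v "Suc m" j, OF that] j by (simp add: U_def)
  have new: "(\<forall>l<n. int (passage u (stair m (Suc j) l) (Suc l)) \<le> (y(j := z)) l) \<longleftrightarrow>
      B u \<and> int (U u + u (Suc m) (Suc j)) \<le> z" for u z
  proof -
    have "stair m (Suc j) l = stair m j l" if "l \<noteq> j" for l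
      using that by (auto simp: stair_def)
    moreover have "passage u (stair m (Suc j) j) (Suc j) = U u + u (Suc m) (Suc j)"
      by (simp add: stair_def U_def)
    ultimately show ?thesis using j by (auto simp: B_def)
  qed
  have old: "(\<forall>l<n. int (passage u (stair m j l) (Suc l)) \<le> y l) \<longleftrightarrow> B u \<and> int (U u) \<le> y j" for u
  proof -
    have "int (passage u (Suc m) j) \<le> y j" if "B u" "int (passage u m (Suc j)) \<le> y j"
    proof (cases j)
      case 0
      with that(2) show ?thesis by simp
    next
      case (Suc i)
      with j have "i < n" "i \<noteq> j" "stair m j i = Suc m" by (simp_all add: stair_def)
      with that(1) Suc have "int (passage u (Suc m) j) \<le> y i"
        unfolding B_def by metis
      also have "y i \<le> y j" using Suc j by (intro mono_onD[OF y]) auto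
      finally show ?thesis .
    qed
    then have "B u \<and> int (U u) \<le> y j \<longleftrightarrow> B u \<and> int (passage u m (Suc j)) \<le> y j"
      by (auto simp: U_def)
    also have "\<dots> \<longleftrightarrow> (\<forall>l<n. int (passage u (stair m j l) (Suc l)) \<le> y l)"
      using j by (auto simp: B_def stair_def)
    finally show ?thesis by blast
  qed
  have "passage_cdf n (stair m (Suc j)) y =
      prob {\<omega> \<in> space M. B (weights \<omega>) \<and> int (U (weights \<omega>) + w (Suc m) (Suc j) \<omega>) \<le> y j}"
    unfolding passage_cdf_def by (simp only: new[of _ "y j", unfolded fun_upd_triv])
  also have "\<dots> =
      q * prob {\<omega> \<in> space M. B (weights \<omega>) \<and> int (U (weights \<omega>) + w (Suc m) (Suc j) \<omega>) \<le> y j - 1} +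
      (1 - q) * prob {\<omega> \<in> space M. B (weights \<omega>) \<and> int (U (weights \<omega>)) \<le> y j}"
    by (rule memoryless[where K = ?K, OF _ _ _ _ _ B_cong U_cong]) auto
  finally show ?thesis
    unfolding passage_cdf_def new old .
qed

lemma passage_cdf_eq_diff_det_step:
  assumes "j < n"
    and hyp: "\<And>y. mono_on {..<n} y \<Longrightarrow>
      passage_cdf n (stair m j) y = diff_det q n (stair m j) y"
    and "mono_on {..<n} y"
  shows "passage_cdf n (stair m (Suc j)) y = diff_det q n (stair m (Suc j)) y"
  using assms(3)
proof (induction "\<Sum>l<n. nat (y l + 1)" arbitrary: y rule: less_induct)
  case less
  let ?t = "stair m (Suc j)" and ?y = "y(j := y j - 1)"
  let ?z = "truncate_below j ?y"
  note y = less.prems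
  have le: "y i \<le> y k" if "i \<le> k" "k < n" for i k
    using that by (intro mono_onD[OF y]) auto
  show ?case
  proof (cases "y 0 < 0")
    case True
    then show ?thesis using \<open>j < n\<close> by (simp add: passage_cdf_eq_0 diff_det_eq_0)
  next
    case False
    have z: "?z l = (if l \<le> j then min (y l) (y j - 1) else y l)" for l
      by (auto simp: truncate_below_def)
    have "mono_on {..<n} ?z"
    proof (rule mono_onI)
      fix i k assume "i \<in> {..<n}" "k \<in> {..<n}" "i \<le> k"
      then show "?z i \<le> ?z k"
        using le[of i k] le[of i j] le[of j k] \<open>j < n\<close> by (auto simp: z min_def)
    qed
    moreover have "(\<Sum>l<n. nat (?z l + 1)) < (\<Sum>l<n. nat (y l + 1))"
    proof (rule sum_strict_mono_ex1)
      show "\<forall>l\<in>{..<n}. nat (?z l + 1) \<le> nat (y l + 1)"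
        by (auto simp: z)
      have "y j \<ge> 0" using False le[of 0 j] \<open>j < n\<close> by simp
      then show "\<exists>l\<in>{..<n}. nat (?z l + 1) < nat (y l + 1)"
        using \<open>j < n\<close> by (intro bexI[of _ j]) (auto simp: z)
    qed simp
    ultimately have IH: "passage_cdf n ?t ?z = diff_det q n ?t ?z"
      by (intro less.hyps)
    have "passage_cdf n ?t ?y = passage_cdf n ?t ?z"
      by (rule passage_cdf_truncate[OF \<open>j < n\<close>]) (simp add: stair_def)
    moreover have "diff_det q n ?t ?y = diff_det q n ?t ?z"
      by (rule diff_det_truncate[OF \<open>j < n\<close>]) (use le \<open>j < n\<close> in \<open>auto simp: stair_def\<close>)
    moreover have "diff_det q n ?t y = q * diff_det q n ?t ?y + (1 - q) * diff_det q n (stair m j) y"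
      by (rule diff_det_step) (use q_pos \<open>j < n\<close> in \<open>auto simp: stair_def\<close>)
    ultimately show ?thesis
      using passage_cdf_step[OF \<open>j < n\<close> y, of m] IH hyp[OF y] by simp
  qed
qed

lemma passage_cdf_eq_diff_det:
  assumes "0 < n" "mono_on {..<n} y"
  shows "passage_cdf n (\<lambda>_. m) y = diff_det q n (\<lambda>_. m) y"
  using assms(2)
proof (induction m arbitrary: y)
  case 0
  show ?case
  proof (cases "y 0 < 0")
    case True
    then show ?thesis using \<open>0 < n\<close> by (simp add: passage_cdf_eq_0 diff_det_eq_0)
  next
    case False
    have "y j \<ge> 0" if "j < n" for j
      using mono_onD[OF 0, of 0 j] that False by simp
    then show ?thesis by (simp add: passage_cdf_time_0 diff_det_time_0)
  qed
next
  case (Suc m)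
  have "passage_cdf n (stair m j) y = diff_det q n (stair m j) y"
    if "j \<le> n" "mono_on {..<n} y" for j y
    using that
  proof (induction j arbitrary: y)
    case 0
    have "stair m 0 = (\<lambda>_. m)" by (simp add: stair_def)
    with Suc.IH 0 show ?case by simp
  next
    case (Suc j)
    then show ?case by (intro passage_cdf_eq_diff_det_step) simp_all
  qed
  moreover have "stair m n l = Suc m" if "l < n" for l
    using that by (simp add: stair_def)
  ultimately show ?case
    using Suc.prems passage_cdf_cong[of n "stair m n" "\<lambda>_. Suc m" y]
      diff_det_cong[of n "stair m n" "\<lambda>_. Suc m" y y] by simp
qed

end

theorem theorem2p2:
  fixes M :: "'a measure" and w :: "nat \<Rightarrow> nat \<Rightarrow> 'a \<Rightarrow> nat"
    and q :: real and m n \<eta> :: nat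
  assumes "prob_space M"
    and "0 < q" and "q < 1"
    and "prob_space.indep_vars M (\<lambda>_. count_space UNIV) (\<lambda>(i, j). w i j) ({1..} \<times> {1..})"
    and "\<And>i j k. i \<ge> 1 \<Longrightarrow> j \<ge> 1 \<Longrightarrow>
           measure M {\<omega> \<in> space M. w i j \<omega> = k} = (1 - q) * q ^ k"
    and "m \<ge> n" and "n \<ge> 1"
  shows "measure M {\<omega> \<in> space M. last_passage (\<lambda>i j. w i j \<omega>) m n \<le> \<eta>} =
         Determinant.det (Matrix.mat n n
           (\<lambda>(i, j). fdiff_pow (int j - int i - 1) (neg_binomial q m) (int \<eta> + 1)))"
proof -
  interpret prob_space M by fact
  interpret geometric_weights M w q
    by unfold_locales (use assms in auto)
  have "last_passage u m n \<le> \<eta> \<longleftrightarrow> (\<forall>l<n. int (passage u m (Suc l)) \<le> int \<eta>)" for u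
  proof -
    have "last_passage u m n = passage u m n"
      using assms by (intro last_passage_eq_passage) simp_all
    moreover have "passage u m (Suc l) \<le> passage u m n" if "l < n" for l
      using that by (intro passage_mono_right) simp
    moreover have "Suc (n - 1) = n" "n - 1 < n" using \<open>n \<ge> 1\<close> by simp_all
    ultimately show ?thesis by (metis of_nat_le_iff order_trans)
  qed
  then have "measure M {\<omega> \<in> space M. last_passage (weights \<omega>) m n \<le> \<eta>} =
      passage_cdf n (\<lambda>_. m) (\<lambda>_. int \<eta>)"
    by (simp add: passage_cdf_def)
  also have "\<dots> = diff_det q n (\<lambda>_. m) (\<lambda>_. int \<eta>)"
    using assms by (intro passage_cdf_eq_diff_det) (simp_all add: mono_on_def)
  finally show ?thesis by (simp add: diff_det_def)
qed

end
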